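(* Let $n\ge1$ and $G=\{-1,1\}^n$. Let $\mathcal T\subseteq 2^{[n]}$ be the collection of all subsets $S\subseteq[n]$ with $|S|\le\lceil n/2\rceil$ and $|S|\equiv\lceil n/2\rceil\pmod 2$. Suppose $f(x)=A_\emptyset+\sum_{1\le i<j\le n}A_{ij}x_ix_j$ (with real coefficients) is nonnegative on $G$. Then there is a collection $(h_k)_{k=1}^{|\mathcal T|}$ of functions $h_k:G\to\mathbb R$, each supported on $\mathcal T$, such that $f(x)=\sum_{k=1}^{|\mathcal T|}h_k(x)^2$ for all $x\in G$. Consequently, any such nonnegative quadratic form on $G$ is a sum of squares of functions of degree at most $\lceil n/2\rceil$.
   Context: $[n]=\{1,\dots,n\}$. Every function $h:\{-1,1\}^n\to\mathbb R$ has a unique expansion $h(x)=\sum_{S\subseteq[n]}\hat h(S)\prod_{i\in S}x_i$. $h$ is supported on $\mathcal T\subseteq 2^{[n]}$ if $\hat h(S)=0$ for all $S\notin\mathcal T$, and $h$ has degree at most $d$ if $\hat h(S)=0$ whenever $|S|>d$. *)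

theory Defs
  imports Complex_Main "HOL-Library.FuncSet" "HOL-Number_Theory.Cong"
begin

text \<open>
  A point of the cube is an extensional function on \<open>{1..n}\<close>, so that the cube is a
  finite set with exactly \<open>2 ^ n\<close> elements. A real function on the cube is represented by a
  function of type \<open>(nat \<Rightarrow> real) \<Rightarrow> real\<close>; its values off the cube are irrelevant
  to all notions below.
\<close>

definition cube :: "nat \<Rightarrow> (nat \<Rightarrow> real) set" where
  "cube n = PiE {1..n} (\<lambda>_. {-1, 1})"

definition is_fourier_expansion ::
    "nat \<Rightarrow> ((nat \<Rightarrow> real) \<Rightarrow> real) \<Rightarrow> (nat set \<Rightarrow> real) \<Rightarrow> bool" where
  "is_fourier_expansion n h c \<longleftrightarrow>
     (\<forall>S. \<not> S \<subseteq> {1..n} \<longrightarrow> c S = 0) \<and>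
     (\<forall>x\<in>cube n. h x = (\<Sum>S\<in>Pow {1..n}. c S * (\<Prod>i\<in>S. x i)))"

text \<open>
  The description is proper: \<open>is_fourier_expansion_ex1\<close> below shows that every
  function has exactly one expansion.
\<close>

definition fourier_coeff :: "nat \<Rightarrow> ((nat \<Rightarrow> real) \<Rightarrow> real) \<Rightarrow> nat set \<Rightarrow> real" where
  "fourier_coeff n h = (THE c. is_fourier_expansion n h c)"

definition supported_on :: "nat \<Rightarrow> ((nat \<Rightarrow> real) \<Rightarrow> real) \<Rightarrow> nat set set \<Rightarrow> bool" where
  "supported_on n h T \<longleftrightarrow> (\<forall>S. S \<subseteq> {1..n} \<and> S \<notin> T \<longrightarrow> fourier_coeff n h S = 0)"

definition degree_at_most :: "nat \<Rightarrow> ((nat \<Rightarrow> real) \<Rightarrow> real) \<Rightarrow> nat \<Rightarrow> bool" where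
  "degree_at_most n h d \<longleftrightarrow> (\<forall>S. S \<subseteq> {1..n} \<and> card S > d \<longrightarrow> fourier_coeff n h S = 0)"

definition half_ceil :: "nat \<Rightarrow> nat" where
  "half_ceil n = nat \<lceil>real n / 2\<rceil>"

definition parity_sets :: "nat \<Rightarrow> nat set set" where
  "parity_sets n =
     {S. S \<subseteq> {1..n} \<and> card S \<le> half_ceil n \<and> [card S = half_ceil n] (mod 2)}"

lemma finite_cube: "finite (cube n)"
  unfolding cube_def by (intro finite_PiE) auto

lemma prod_mult_sum_cube:
  assumes "S \<subseteq> {1..n}" "T \<subseteq> {1..n}"
  shows "(\<Sum>x\<in>cube n. (\<Prod>i\<in>S. x i) * (\<Prod>i\<in>T. x i)) = (if S = T then 2 ^ n else 0)"
proof -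
  let ?g = "\<lambda>i (v::real). (if i \<in> S then v else 1) * (if i \<in> T then v else 1)"
  have "(\<Prod>i\<in>S. x i) * (\<Prod>i\<in>T. x i) = (\<Prod>i\<in>{1..n}. ?g i (x i))" for x :: "nat \<Rightarrow> real"
  proof -
    have "(\<Prod>i\<in>{1..n}. if i \<in> U then x i else 1) = (\<Prod>i\<in>U. x i)" if "U \<subseteq> {1..n}" for U
      using that by (simp add: prod.inter_restrict[symmetric] Int_absorb1)
    then show ?thesis using assms by (simp add: prod.distrib)
  qed
  then have "(\<Sum>x\<in>cube n. (\<Prod>i\<in>S. x i) * (\<Prod>i\<in>T. x i)) =
      (\<Sum>x\<in>cube n. \<Prod>i\<in>{1..n}. ?g i (x i))" by simp
  also have "\<dots> = (\<Prod>i\<in>{1..n}. \<Sum>v\<in>{-1, 1}. ?g i v)"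
    unfolding cube_def by (rule prod_sum_PiE[symmetric]) auto
  also have "\<dots> = (if S = T then 2 ^ n else 0)"
  proof (cases "S = T")
    case True
    then have "(\<Prod>i\<in>{1..n}. \<Sum>v\<in>{-1, 1}. ?g i v) = (\<Prod>i\<in>{1..n}. (2::real))"
      by (intro prod.cong) auto
    then show ?thesis using True by simp
  next
    case False
    then obtain i where i: "i \<in> {1..n}" "i \<in> S \<longleftrightarrow> i \<notin> T"
      using assms by blast
    then have "(\<Sum>v\<in>{-1, 1}. ?g i v) = 0" by auto
    then have "(\<Prod>i\<in>{1..n}. \<Sum>v\<in>{-1, 1}. ?g i v) = 0"
      using i(1) by (intro prod_zero) blast+
    then show ?thesis using False by simp
  qed
  finally show ?thesis .
qed

lemma sum_Pow_prod_mult: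
  assumes "x \<in> cube n" "y \<in> cube n"
  shows "(\<Sum>S\<in>Pow {1..n}. (\<Prod>i\<in>S. x i) * (\<Prod>i\<in>S. y i)) = (if x = y then 2 ^ n else 0)"
proof -
  have v: "x i \<in> {-1, 1}" "y i \<in> {-1, 1}" if "i \<in> {1..n}" for i
    using assms that unfolding cube_def by blast+
  have "(\<Sum>S\<in>Pow {1..n}. (\<Prod>i\<in>S. x i) * (\<Prod>i\<in>S. y i)) = (\<Prod>i\<in>{1..n}. x i * y i + 1)"
    by (subst prod_add) (simp_all add: prod.distrib)
  also have "\<dots> = (if x = y then 2 ^ n else 0)"
  proof (cases "x = y")
    case True
    have "(\<Prod>i\<in>{1..n}. x i * y i + 1) = (\<Prod>i\<in>{1..n}. (2::real))"
    proof (intro prod.cong refl)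
      fix i assume "i \<in> {1..n}"
      then show "x i * y i + 1 = 2" using v(1)[of i] True by auto
    qed
    then show ?thesis using True by simp
  next
    case False
    then obtain i where i: "i \<in> {1..n}" "x i \<noteq> y i"
      using assms PiE_ext unfolding cube_def by metis
    then have "x i * y i + 1 = 0" using v[of i] by auto
    then have "(\<Prod>i\<in>{1..n}. x i * y i + 1) = 0"
      using i(1) by (intro prod_zero) blast+
    then show ?thesis using False by simp
  qed
  finally show ?thesis .
qed

lemma is_fourier_expansion_coeff:
  assumes "is_fourier_expansion n h c" "T \<subseteq> {1..n}"
  shows "c T = (\<Sum>x\<in>cube n. h x * (\<Prod>i\<in>T. x i)) / 2 ^ n"
proof -
  have "(\<Sum>x\<in>cube n. h x * (\<Prod>i\<in>T. x i)) =
      (\<Sum>x\<in>cube n. \<Sum>S\<in>Pow {1..n}. c S * ((\<Prod>i\<in>S. x i) * (\<Prod>i\<in>T. x i)))"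
    using assms(1) unfolding is_fourier_expansion_def
    by (intro sum.cong) (auto simp: sum_distrib_right mult.assoc)
  also have "\<dots> = (\<Sum>S\<in>Pow {1..n}. c S * (\<Sum>x\<in>cube n. (\<Prod>i\<in>S. x i) * (\<Prod>i\<in>T. x i)))"
    by (subst sum.swap) (simp add: sum_distrib_left)
  also have "\<dots> = (\<Sum>S\<in>Pow {1..n}. if S = T then c T * 2 ^ n else 0)"
    using assms(2) by (intro sum.cong refl) (simp add: prod_mult_sum_cube)
  also have "\<dots> = c T * 2 ^ n"
    using assms(2) by simp
  finally show ?thesis by simp
qed

lemma is_fourier_expansion_ex1: "\<exists>!c. is_fourier_expansion n h c"
proof (rule ex_ex1I)
  define c where "c S = (if S \<subseteq> {1..n} then (\<Sum>y\<in>cube n. h y * (\<Prod>i\<in>S. y i)) / 2 ^ n else 0)"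
    for S
  have "h x = (\<Sum>S\<in>Pow {1..n}. c S * (\<Prod>i\<in>S. x i))" if x: "x \<in> cube n" for x
  proof -
    have "(\<Sum>S\<in>Pow {1..n}. c S * (\<Prod>i\<in>S. x i)) =
        (\<Sum>S\<in>Pow {1..n}. \<Sum>y\<in>cube n. h y / 2 ^ n * ((\<Prod>i\<in>S. y i) * (\<Prod>i\<in>S. x i)))"
      unfolding c_def
      by (intro sum.cong refl)
         (simp add: sum_distrib_left sum_distrib_right sum_divide_distrib mult_ac)
    also have "\<dots> = (\<Sum>y\<in>cube n. h y / 2 ^ n * (\<Sum>S\<in>Pow {1..n}. (\<Prod>i\<in>S. y i) * (\<Prod>i\<in>S. x i)))"
      by (subst sum.swap) (simp only: sum_distrib_left)
    also have "\<dots> = (\<Sum>y\<in>cube n. if y = x then h x else 0)"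
      by (intro sum.cong refl) (simp add: sum_Pow_prod_mult x del: One_nat_def)
    also have "\<dots> = h x" using x finite_cube by simp
    finally show ?thesis by simp
  qed
  then show "\<exists>c. is_fourier_expansion n h c"
    unfolding is_fourier_expansion_def by (intro exI[of _ c]) (auto simp: c_def)
next
  fix c d assume *: "is_fourier_expansion n h c" "is_fourier_expansion n h d"
  show "c = d"
  proof
    fix S show "c S = d S"
    proof (cases "S \<subseteq> {1..n}")
      case True
      then show ?thesis using * by (simp add: is_fourier_expansion_coeff)
    next
      case False
      then show ?thesis using * unfolding is_fourier_expansion_def by simp
    qed
  qed
qed

lemma is_fourier_expansion_fourier_coeff: "is_fourier_expansion n h (fourier_coeff n h)"
  unfolding fourier_coeff_def by (rule theI'[OF is_fourier_expansion_ex1])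

end

theory Submission
  imports Defs
begin

text \<open>
  Let \<open>P\<close> be the class of all subsets of \<open>{1..n}\<close> whose cardinality has the parity of
  \<open>half_ceil n\<close>. With \<open>\<chi>\<^sub>S x = (\<Prod>i\<in>S. x i)\<close>, the matrix
  \<open>M S T = (\<Sum>x. f x * \<chi>\<^sub>S x * \<chi>\<^sub>T x)\<close> on \<open>P\<close> is positive semidefinite because \<open>f\<close> is
  nonnegative, and \<open>M S T = 0\<close> unless the cardinalities of \<open>S\<close> and \<open>T\<close> differ
  by at most 2. Eliminating the indices by decreasing cardinality, a Cholesky factorisation
  of \<open>M\<close> creates no fill-in outside this band. Each factor then gives a function whose
  frequencies have cardinality \<open>k\<close> or \<open>k - 2\<close>; multiplying it by one character
  (which does not change its square) moves these frequencies into \<open>parity_sets n\<close>: the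
  trivial one if \<open>k \<le> half_ceil n\<close>, and otherwise the one of \<open>{1..2 * (n div 2)}\<close>, which is
  nearly a complementation but has even cardinality and so preserves the parity. As
  \<open>2 ^ n * card P * f\<close> is the sum of the squares of these functions, so is \<open>f\<close> after scaling.
  A second factorisation, of the Gram matrix on \<open>parity_sets n\<close>, reduces the number of squares.
\<close>

section \<open>Cholesky factorisation of banded matrices\<close>

text \<open>A vanishing pivot is harmless: then the whole row vanishes, in accordance with \<open>x / 0 = 0\<close>.\<close>

lemma psd_schur_complement:
  fixes M :: "'a \<Rightarrow> 'a \<Rightarrow> real"
  assumes fin: "finite V" and x: "x \<notin> V"
    and sym: "\<And>a b. a \<in> insert x V \<Longrightarrow> b \<in> insert x V \<Longrightarrow> M a b = M b a"
    and psd: "\<And>v. 0 \<le> (\<Sum>a\<in>insert x V. \<Sum>b\<in>insert x V. M a b * v a * v b)"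
  shows "0 \<le> M x x"
    and "M x x = 0 \<Longrightarrow> b \<in> V \<Longrightarrow> M x b = 0"
    and "0 \<le> (\<Sum>a\<in>V. \<Sum>b\<in>V. (M a b - M x a * M x b / M x x) * v a * v b)"
proof -
  have split: "(\<Sum>a\<in>insert x V. \<Sum>b\<in>insert x V. M a b * v a * v b) =
      M x x * (v x)\<^sup>2 + 2 * v x * (\<Sum>b\<in>V. M x b * v b) + (\<Sum>a\<in>V. \<Sum>b\<in>V. M a b * v a * v b)" for v
  proof -
    have "(\<Sum>a\<in>V. M a x * v a * v x) = v x * (\<Sum>b\<in>V. M x b * v b)"
      unfolding sum_distrib_left using sym by (intro sum.cong) (auto simp: mult_ac)
    moreover have "(\<Sum>b\<in>V. M x b * v x * v b) = v x * (\<Sum>b\<in>V. M x b * v b)"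
      unfolding sum_distrib_left by (intro sum.cong) (auto simp: mult_ac)
    ultimately show ?thesis
      using fin x by (simp add: sum.distrib power2_eq_square algebra_simps)
  qed
  \<comment> \<open>For fixed \<open>v\<close> off \<open>x\<close>, the form is a quadratic
    polynomial in the entry \<open>t\<close> at \<open>x\<close>. Each of the three claims comes
    from a suitable choice of \<open>t\<close> and \<open>v\<close>.\<close>
  have psd': "0 \<le> M x x * t\<^sup>2 + 2 * t * (\<Sum>b\<in>V. M x b * v b) + (\<Sum>a\<in>V. \<Sum>b\<in>V. M a b * v a * v b)"
    for t v
  proof -
    have *: "(\<Sum>b\<in>V. M x b * (v(x := t)) b) = (\<Sum>b\<in>V. M x b * v b)"
      "(\<Sum>a\<in>V. \<Sum>b\<in>V. M a b * (v(x := t)) a * (v(x := t)) b) = (\<Sum>a\<in>V. \<Sum>b\<in>V. M a b * v a * v b)"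
      using x by (auto intro!: sum.cong)
    show ?thesis
      using psd[of "v(x := t)"] unfolding split * by simp
  qed
  show pivot: "0 \<le> M x x"
    using psd'[of 1 "\<lambda>_. 0"] by simp
  have row: "M x b = 0" if "M x x = 0" "b \<in> V" for b
  proof (rule ccontr)
    assume neq: "M x b \<noteq> 0"
    define e where "e = (\<lambda>a. if a = b then 1 else (0::real))"
    have "(\<Sum>a\<in>V. M x a * e a) = M x b"
      using fin that(2) by (simp add: e_def if_distrib cong: if_cong)
    then have "0 \<le> 2 * t * M x b + (\<Sum>a\<in>V. \<Sum>b\<in>V. M a b * e a * e b)" for t
      using psd'[of t e] that(1) by simp
    \<comment> \<open>With zero pivot and \<open>v\<close> a unit vector the form is affine in
      \<open>t\<close>; this \<open>t\<close> gives it the value -1.\<close>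
    from this[of "(- (\<Sum>a\<in>V. \<Sum>b\<in>V. M a b * e a * e b) - 1) / (2 * M x b)"]
    show False using neq by (simp add: field_simps)
  qed
  then show "M x x = 0 \<Longrightarrow> b \<in> V \<Longrightarrow> M x b = 0" .
  show "0 \<le> (\<Sum>a\<in>V. \<Sum>b\<in>V. (M a b - M x a * M x b / M x x) * v a * v b)"
  proof -
    define s where "s = (\<Sum>b\<in>V. M x b * v b)"
    have "(\<Sum>a\<in>V. \<Sum>b\<in>V. (M x a * v a) * (M x b * v b)) = s\<^sup>2"
      unfolding s_def power2_eq_square sum_product ..
    then have "(\<Sum>a\<in>V. \<Sum>b\<in>V. M x a * M x b / M x x * v a * v b) = s\<^sup>2 / M x x"
      by (simp add: sum_divide_distrib[symmetric] mult_ac)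
    then have *: "(\<Sum>a\<in>V. \<Sum>b\<in>V. (M a b - M x a * M x b / M x x) * v a * v b) =
        (\<Sum>a\<in>V. \<Sum>b\<in>V. M a b * v a * v b) - s\<^sup>2 / M x x"
      by (simp add: left_diff_distrib sum_subtractf)
    show ?thesis
    proof (cases "M x x = 0")
      case True
      then show ?thesis using psd'[of 0 v] * by simp
    next
      case False
      \<comment> \<open>This \<open>t\<close> minimises the quadratic polynomial, and the minimum is
        the Schur complement form.\<close>
      then show ?thesis
        using psd'[of "- s / M x x" v] unfolding * s_def[symmetric]
        by (simp add: power2_eq_square field_simps)
    qed
  qed
qed

text \<open>The induction eliminates an index \<open>x\<close> of greatest level first. The nonzero
  entries of its row have levels between \<open>lev x - w\<close> and \<open>lev x\<close>, so
  subtracting the rank-one term creates no entry outside the band.\<close>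

lemma banded_cholesky:
  fixes M :: "'a \<Rightarrow> 'a \<Rightarrow> real" and lev :: "'a \<Rightarrow> nat"
  assumes "finite V"
    and "\<And>a b. a \<in> V \<Longrightarrow> b \<in> V \<Longrightarrow> M a b = M b a"
    and "\<And>v. 0 \<le> (\<Sum>a\<in>V. \<Sum>b\<in>V. M a b * v a * v b)"
    and "\<And>a b. a \<in> V \<Longrightarrow> b \<in> V \<Longrightarrow> M a b \<noteq> 0 \<Longrightarrow> lev a \<le> lev b + w"
  shows "\<exists>L. (\<forall>a\<in>V. \<forall>b\<in>V. M a b = (\<Sum>c\<in>V. L c a * L c b)) \<and>
             (\<forall>c\<in>V. \<forall>b\<in>V. L c b \<noteq> 0 \<longrightarrow> lev b \<le> lev c \<and> lev c \<le> lev b + w)"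
  using assms
proof (induction V arbitrary: M rule: finite_ranking_induct[where f = lev])
  case empty
  then show ?case by simp
next
  case (insert x V)
  show ?case
  proof (cases "x \<in> V")
    \<comment> \<open>The ranking induction allows the inserted element to be present
      already.\<close>
    case True
    then have "insert x V = V" by blast
    then show ?thesis using insert.IH[of M] insert.prems by simp
  next
    case x: False
    note sym = insert.prems(1) and psd = insert.prems(2) and band = insert.prems(3)
    note schur = psd_schur_complement[OF insert.hyps(1) x sym psd]
    define M' where "M' a b = M a b - M x a * M x b / M x x" for a b
    have "\<exists>L. (\<forall>a\<in>V. \<forall>b\<in>V. M' a b = (\<Sum>c\<in>V. L c a * L c b)) \<and>
             (\<forall>c\<in>V. \<forall>b\<in>V. L c b \<noteq> 0 \<longrightarrow> lev b \<le> lev c \<and> lev c \<le> lev b + w)"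
    proof (rule insert.IH)
      show "M' a b = M' b a" if "a \<in> V" "b \<in> V" for a b
        using sym[of a b] that by (simp add: M'_def)
      show "0 \<le> (\<Sum>a\<in>V. \<Sum>b\<in>V. M' a b * v a * v b)" for v
        using schur(3) by (simp add: M'_def)
      show "lev a \<le> lev b + w" if "a \<in> V" "b \<in> V" "M' a b \<noteq> 0" for a b
      proof (cases "M a b = 0")
        case True
        then have "M x b \<noteq> 0" using that(3) by (auto simp: M'_def)
        \<comment> \<open>A fill-in entry satisfies
          \<open>lev a \<le> lev x \<le> lev b + w\<close>.\<close>
        then show ?thesis using band[of x b] insert.hyps(2)[of a] that by force
      next
        case False
        then show ?thesis using band that by simp
      qed
    qed
    then obtain L where L: "\<And>a b. a \<in> V \<Longrightarrow> b \<in> V \<Longrightarrow> M' a b = (\<Sum>c\<in>V. L c a * L c b)"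
      "\<And>c b. c \<in> V \<Longrightarrow> b \<in> V \<Longrightarrow> L c b \<noteq> 0 \<Longrightarrow> lev b \<le> lev c \<and> lev c \<le> lev b + w"
      by blast
    \<comment> \<open>The new row is the row of the pivot, normalised; the old rows vanish in column
      \<open>x\<close>. For a zero pivot the new row is zero.\<close>
    define L' where "L' c b = (if c = x then M x b / sqrt (M x x) else if b = x then 0 else L c b)"
      for c b
    have expand: "(\<Sum>c\<in>insert x V. L' c a * L' c b) =
        M x a * M x b / M x x + (if a = x \<or> b = x then 0 else \<Sum>c\<in>V. L c a * L c b)" for a b
    proof -
      have "(\<Sum>c\<in>V. L' c a * L' c b) = (if a = x \<or> b = x then 0 else \<Sum>c\<in>V. L c a * L c b)"
        using x by (auto simp: L'_def intro!: sum.cong sum.neutral)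
      moreover have "L' x a * L' x b = M x a * M x b / M x x"
        using schur(1) by (simp add: L'_def)
      ultimately show ?thesis using insert.hyps(1) x by simp
    qed
    have "M a b = (\<Sum>c\<in>insert x V. L' c a * L' c b)" if "a \<in> insert x V" "b \<in> insert x V" for a b
      unfolding expand using that sym[of a x] schur(2) L(1)[of a b, symmetric]
      by (cases "M x x = 0") (auto simp: M'_def)
    moreover have "lev b \<le> lev c \<and> lev c \<le> lev b + w"
      if "c \<in> insert x V" "b \<in> insert x V" "L' c b \<noteq> 0" for b c
      using that L(2)[of c b] insert.hyps(2)[of b] band[of x b]
      by (auto simp: L'_def split: if_splits)
    ultimately show ?thesis by blast
  qed
qed

section \<open>Gram matrices and the number of squares\<close>

lemma gram_quadratic_form:
  fixes l :: "'c \<Rightarrow> 'a \<Rightarrow> real"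
  shows "(\<Sum>a\<in>T. \<Sum>b\<in>T. (\<Sum>k\<in>J. l k a * l k b) * v a * v b) = (\<Sum>k\<in>J. (\<Sum>a\<in>T. l k a * v a)\<^sup>2)"
proof -
  have "(\<Sum>a\<in>T. \<Sum>b\<in>T. (\<Sum>k\<in>J. l k a * l k b) * v a * v b) =
      (\<Sum>a\<in>T. \<Sum>b\<in>T. \<Sum>k\<in>J. (l k a * v a) * (l k b * v b))"
    by (simp add: sum_distrib_left sum_distrib_right mult_ac)
  also have "\<dots> = (\<Sum>a\<in>T. \<Sum>k\<in>J. \<Sum>b\<in>T. (l k a * v a) * (l k b * v b))"
    by (intro sum.cong refl sum.swap)
  also have "\<dots> = (\<Sum>k\<in>J. (\<Sum>a\<in>T. l k a * v a)\<^sup>2)"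
    by (subst sum.swap) (simp add: power2_eq_square sum_product)
  finally show ?thesis .
qed

text \<open>A sum of squares of linear forms depends only on its Gram matrix, and a Cholesky factor
  of that matrix has one row for each element of \<open>T\<close>.\<close>

lemma sum_squares_card:
  fixes g :: "'b \<Rightarrow> 'a \<Rightarrow> real"
  assumes "finite T"
  shows "\<exists>L. \<forall>\<chi>. (\<Sum>k\<in>K. (\<Sum>a\<in>T. g k a * \<chi> a)\<^sup>2) = (\<Sum>c\<in>T. (\<Sum>a\<in>T. L c a * \<chi> a)\<^sup>2)"
proof -
  define N where "N a b = (\<Sum>k\<in>K. g k a * g k b)" for a b
  \<comment> \<open>Constant level 0 and width 0 make the band condition void.\<close>
  have "\<exists>L. (\<forall>a\<in>T. \<forall>b\<in>T. N a b = (\<Sum>c\<in>T. L c a * L c b)) \<and>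
      (\<forall>c\<in>T. \<forall>b\<in>T. L c b \<noteq> 0 \<longrightarrow> (0::nat) \<le> 0 \<and> (0::nat) \<le> 0 + 0)"
  proof (rule banded_cholesky[OF assms])
    show "N a b = N b a" for a b by (simp add: N_def mult.commute)
    show "0 \<le> (\<Sum>a\<in>T. \<Sum>b\<in>T. N a b * v a * v b)" for v
      unfolding N_def gram_quadratic_form by (simp add: sum_nonneg)
  qed simp
  then obtain L where L: "\<And>a b. a \<in> T \<Longrightarrow> b \<in> T \<Longrightarrow> N a b = (\<Sum>c\<in>T. L c a * L c b)"
    by blast
  have "(\<Sum>k\<in>K. (\<Sum>a\<in>T. g k a * \<chi> a)\<^sup>2) = (\<Sum>c\<in>T. (\<Sum>a\<in>T. L c a * \<chi> a)\<^sup>2)" for \<chi>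
    unfolding gram_quadratic_form[symmetric] using L by (intro sum.cong) (auto simp: N_def)
  then show ?thesis by blast
qed

section \<open>Characters of the cube\<close>

abbreviation walsh :: "nat set \<Rightarrow> (nat \<Rightarrow> real) \<Rightarrow> real" where
  "walsh S x \<equiv> \<Prod>i\<in>S. x i"

abbreviation symd :: "'a set \<Rightarrow> 'a set \<Rightarrow> 'a set" where
  "symd S T \<equiv> (S - T) \<union> (T - S)"

lemma card_symd:
  assumes "finite S" "finite T"
  shows "card (symd S T) + 2 * card (S \<inter> T) = card S + card T"
proof -
  have "card (symd S T) = card (S - T) + card (T - S)"
    using assms by (intro card_Un_disjoint) auto
  moreover have "card S = card (S - T) + card (S \<inter> T)"
    using assms by (metis card_Int_Diff add.commute)
  moreover have "card T = card (T - S) + card (S \<inter> T)"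
    using assms by (metis card_Int_Diff add.commute Int_commute)
  ultimately show ?thesis by simp
qed

lemma cube_square: "x \<in> cube n \<Longrightarrow> i \<in> {1..n} \<Longrightarrow> x i * x i = 1"
  unfolding cube_def by (drule PiE_mem, assumption) auto

lemma walsh_square:
  assumes "x \<in> cube n" "S \<subseteq> {1..n}"
  shows "walsh S x * walsh S x = 1"
  unfolding prod.distrib[symmetric] using assms
  by (intro prod.neutral) (auto simp: cube_square)

lemma walsh_symd:
  assumes x: "x \<in> cube n" and S: "S \<subseteq> {1..n}" and T: "T \<subseteq> {1..n}"
  shows "walsh (symd S T) x = walsh S x * walsh T x"
proof -
  have fin: "finite S" "finite T" using S T finite_subset by blast+
  have "walsh S x = walsh (S - T) x * walsh (S \<inter> T) x"
    using prod.Int_Diff[OF fin(1), of x T] by (simp add: mult.commute)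
  moreover have "walsh T x = walsh (T - S) x * walsh (S \<inter> T) x"
    using prod.Int_Diff[OF fin(2), of x S] by (simp add: mult.commute Int_commute)
  moreover have "walsh (symd S T) x = walsh (S - T) x * walsh (T - S) x"
    using fin by (intro prod.union_disjoint) auto
  moreover have "walsh (S \<inter> T) x * walsh (S \<inter> T) x = 1"
    using S by (intro walsh_square[OF x]) auto
  ultimately show ?thesis by (simp add: mult_ac)
qed

text \<open>By uniqueness of the expansion, \<open>g\<close> extended by zero is the coefficient
  function of \<open>h\<close>.\<close>

lemma supported_on_walsh_sum:
  assumes "T \<subseteq> Pow {1..n}" and h: "\<forall>x\<in>cube n. h x = (\<Sum>S\<in>T. g S * walsh S x)"
  shows "supported_on n h T"
proof -
  define c where "c S = (if S \<in> T then g S else 0)" for S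
  have "(\<Sum>S\<in>T. g S * walsh S x) = (\<Sum>S\<in>Pow {1..n}. c S * walsh S x)" for x
    using assms(1) by (intro sum.mono_neutral_cong_left) (auto simp: c_def)
  then have "is_fourier_expansion n h c"
    using assms by (auto simp: is_fourier_expansion_def c_def)
  then have "fourier_coeff n h = c"
    using is_fourier_expansion_ex1 is_fourier_expansion_fourier_coeff by blast
  then show ?thesis by (simp add: supported_on_def c_def)
qed

lemma walsh_expansion:
  assumes "x \<in> cube n"
  shows "2 ^ n * h x = (\<Sum>T\<in>Pow {1..n}. (\<Sum>y\<in>cube n. h y * walsh T y) * walsh T x)"
proof -
  note F = is_fourier_expansion_fourier_coeff[of n h]
  have "h x = (\<Sum>T\<in>Pow {1..n}. (\<Sum>y\<in>cube n. h y * walsh T y) / 2 ^ n * walsh T x)"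
    using F assms is_fourier_expansion_coeff[OF F] by (simp add: is_fourier_expansion_def)
  then have "h x = (\<Sum>T\<in>Pow {1..n}. (\<Sum>y\<in>cube n. h y * walsh T y) * walsh T x) / 2 ^ n"
    by (simp only: sum_divide_distrib[where A = "Pow {1..n}"] times_divide_eq_left)
  then show ?thesis by (simp add: field_simps)
qed

text \<open>Multiplying \<open>walsh S\<close> by \<open>x i * x j\<close> gives the character of
  \<open>symd {i, j} S\<close>, whose cardinality differs from that of \<open>S\<close> by 0 or 2;
  orthogonality to \<open>walsh T\<close> does the rest.\<close>

lemma quadratic_moment_sparse:
  assumes f: "\<forall>x\<in>cube n. f x =
           A0 + (\<Sum>(i, j) \<in> {(i, j). 1 \<le> i \<and> i < j \<and> j \<le> n}. A i j * x i * x j)"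
    and S: "S \<subseteq> {1..n}" and T: "T \<subseteq> {1..n}"
    and nz: "(\<Sum>x\<in>cube n. f x * walsh S x * walsh T x) \<noteq> 0"
  shows "card S = card T \<or> card S = card T + 2 \<or> card T = card S + 2"
proof (rule ccontr)
  assume neg: "\<not> ?thesis"
  define E where "E = {(i, j). 1 \<le> i \<and> i < j \<and> j \<le> n}"
  have pair: "(\<Sum>x\<in>cube n. x i * x j * walsh S x * walsh T x) = 0" if ij: "(i, j) \<in> E" for i j
  proof -
    have sub: "{i, j} \<subseteq> {1..n}" and ne: "i \<noteq> j" using ij by (auto simp: E_def)
    have sub': "symd {i, j} S \<subseteq> {1..n}" using S sub by blast
    have "symd {i, j} S \<noteq> T"
    proof
      assume eq: "symd {i, j} S = T"
      have "card T + 2 * card ({i, j} \<inter> S) = 2 + card S"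
        using card_symd[of "{i, j}" S] S ne finite_subset[OF S] unfolding eq by simp
      moreover have "card ({i, j} \<inter> S) \<le> card {i, j}"
        by (intro card_mono) auto
      ultimately show False using neg ne by (simp add: numeral_2_eq_2) arith
    qed
    moreover have "(\<Sum>x\<in>cube n. x i * x j * walsh S x * walsh T x) =
        (\<Sum>x\<in>cube n. walsh (symd {i, j} S) x * walsh T x)"
      using ne by (intro sum.cong refl) (simp add: walsh_symd[OF _ sub S])
    ultimately show ?thesis
      using prod_mult_sum_cube[OF sub' T] by (simp only: if_False)
  qed
  have "(\<Sum>x\<in>cube n. f x * walsh S x * walsh T x) =
      (\<Sum>x\<in>cube n. A0 * (walsh S x * walsh T x) +
        (\<Sum>(i, j)\<in>E. A i j * (x i * x j * walsh S x * walsh T x)))"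
    using f unfolding E_def[symmetric]
    by (intro sum.cong refl)
       (simp add: distrib_right sum_distrib_right case_prod_unfold mult.assoc)
  also have "\<dots> = A0 * (\<Sum>x\<in>cube n. walsh S x * walsh T x) +
      (\<Sum>(i, j)\<in>E. A i j * (\<Sum>x\<in>cube n. x i * x j * walsh S x * walsh T x))"
    by (simp add: sum.distrib sum_distrib_left case_prod_unfold sum.swap[of _ E])
  also have "\<dots> = 0"
    using prod_mult_sum_cube[OF S T] neg pair by (auto intro!: sum.neutral)
  finally show False using nz by simp
qed

section \<open>Translation into the lower half of the cube\<close>

definition parity_class :: "nat \<Rightarrow> nat set set" where
  "parity_class n = {S. S \<subseteq> {1..n} \<and> even (card S + half_ceil n)}"

lemma half_ceil_eq: "half_ceil n = (n + 1) div 2"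
  unfolding half_ceil_def using ceiling_divide_eq_div[of "int n" 2, where ?'a = real] by simp

lemma parity_sets_eq: "parity_sets n = {S \<in> parity_class n. card S \<le> half_ceil n}"
  unfolding parity_sets_def parity_class_def cong_def by (auto simp: mod2_eq_if split: if_splits)

text \<open>At most \<open>n mod 2\<close> elements of \<open>S\<close> lie outside
  \<open>{1..2 * (n div 2)}\<close>, so the new cardinality is at most
  \<open>n + n mod 2 - card S\<close>, that is \<open>2 * half_ceil n - card S\<close>.\<close>

lemma symd_lower_half:
  assumes S: "S \<in> parity_class n" "half_ceil n \<le> card S"
  shows "symd S {1..2 * (n div 2)} \<in> parity_sets n"
proof -
  let ?U = "{1..2 * (n div 2)}"
  have sub: "S \<subseteq> {1..n}" using S by (simp add: parity_class_def)
  have fin: "finite S" using sub finite_subset by blast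
  have UN: "?U \<subseteq> {1..n}" by auto
  have 1: "card (symd S ?U) + 2 * card (S \<inter> ?U) = card S + 2 * (n div 2)"
    using card_symd[OF fin, of ?U] by simp
  have "card S \<le> card (S \<inter> ?U) + card ({1..n} - ?U)"
  proof -
    have "card S \<le> card ((S \<inter> ?U) \<union> ({1..n} - ?U))"
      using sub fin by (intro card_mono) auto
    also have "\<dots> \<le> card (S \<inter> ?U) + card ({1..n} - ?U)" by (rule card_Un_le)
    finally show ?thesis .
  qed
  also have "card ({1..n} - ?U) = n - 2 * (n div 2)"
    using card_Diff_subset[OF _ UN] by simp
  finally have 2: "card S \<le> card (S \<inter> ?U) + (n - 2 * (n div 2))" .
  have "card (symd S ?U) \<le> half_ceil n"
    using 1 2 S(2) unfolding half_ceil_eq by (cases "even n") (auto elim!: evenE oddE)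
  moreover have "even (card (symd S ?U) + half_ceil n)"
    using arg_cong[OF 1, of even] S(1) by (simp add: parity_class_def)
  ultimately show ?thesis
    using sub UN by (auto simp: parity_sets_eq parity_class_def)
qed

text \<open>Parity keeps the band of cardinalities \<open>k - 2\<close> to \<open>k\<close> from
  straddling \<open>half_ceil n\<close>, so one character moves all of it.\<close>

lemma translate_band:
  assumes band: "\<And>b. b \<in> parity_class n \<Longrightarrow> l b \<noteq> 0 \<Longrightarrow> card b \<le> k \<and> k \<le> card b + 2"
    and k: "even (k + half_ceil n)"
  shows "\<exists>g. \<forall>x\<in>cube n. (\<Sum>b\<in>parity_class n. l b * walsh b x)\<^sup>2 =
    (\<Sum>S\<in>parity_sets n. g S * walsh S x)\<^sup>2"
proof -
  obtain U where U: "U \<subseteq> {1..n}"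
    and move: "\<And>b. b \<in> parity_class n \<Longrightarrow> l b \<noteq> 0 \<Longrightarrow> symd b U \<in> parity_sets n"
  proof (cases "k \<le> half_ceil n")
    case True
    then show ?thesis
      using band by (intro that[of "{}"]) (force simp: parity_sets_eq)+
  next
    case False
    \<comment> \<open>Parity rules out \<open>k = half_ceil n + 1\<close>, so every frequency has
      cardinality at least \<open>half_ceil n\<close>.\<close>
    then have "half_ceil n + 2 \<le> k" using k by presburger
    then show ?thesis
      using band by (intro that[of "{1..2 * (n div 2)}"] symd_lower_half) force+
  qed
  have inv: "symd (symd b U) U = b" for b by blast
  have finP: "finite (parity_class n)" "finite (parity_sets n)"
    by (auto simp: parity_sets_eq parity_class_def)
  define g where "g S = (if symd S U \<in> parity_class n then l (symd S U) else 0)" for S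
  have "(\<Sum>b\<in>parity_class n. l b * walsh b x)\<^sup>2 = (\<Sum>S\<in>parity_sets n. g S * walsh S x)\<^sup>2"
    if x: "x \<in> cube n" for x
  proof -
    have "walsh U x * (\<Sum>b\<in>parity_class n. l b * walsh b x) =
        (\<Sum>b\<in>parity_class n. l b * walsh (symd b U) x)"
      unfolding sum_distrib_left using x U
      by (intro sum.cong refl) (simp add: parity_class_def walsh_symd)
    also have "\<dots> = (\<Sum>S\<in>parity_sets n. g S * walsh S x)"
      \<comment> \<open>The involution \<open>symd _ U\<close> need not map
        \<open>parity_class n\<close> into \<open>parity_sets n\<close>; it does so where
        \<open>l\<close> is nonzero, and the other terms are dropped.\<close>
      by (rule sum.reindex_bij_witness_not_neutral[where i = "\<lambda>S. symd S U" and j = "\<lambda>b. symd b U"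
            and S' = "{b \<in> parity_class n. l b = 0}" and T' = "{S \<in> parity_sets n. g S = 0}"])
         (use finP move in \<open>auto simp: inv g_def split: if_splits\<close>)
    finally have "(\<Sum>S\<in>parity_sets n. g S * walsh S x)\<^sup>2 =
        (walsh U x)\<^sup>2 * (\<Sum>b\<in>parity_class n. l b * walsh b x)\<^sup>2"
      by (metis power_mult_distrib)
    then show ?thesis using walsh_square[OF x U] by (simp add: power2_eq_square)
  qed
  then show ?thesis by blast
qed

section \<open>Assembly of the sum of squares\<close>

lemma quadratic_sum_of_squares:
  assumes f: "\<forall>x\<in>cube n. f x =
           A0 + (\<Sum>(i, j) \<in> {(i, j). 1 \<le> i \<and> i < j \<and> j \<le> n}. A i j * x i * x j)"
    and nonneg: "\<forall>x\<in>cube n. f x \<ge> 0"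
  shows "\<exists>L. \<forall>x\<in>cube n. f x = (\<Sum>c\<in>parity_sets n. (\<Sum>S\<in>parity_sets n. L c S * walsh S x)\<^sup>2)"
proof -
  let ?P = "parity_class n"
  have finP: "finite ?P" "finite (parity_sets n)"
    by (auto simp: parity_sets_eq parity_class_def)
  define M where "M S T = (\<Sum>x\<in>cube n. f x * walsh S x * walsh T x)" for S T
  have sparse: "card S = card T \<or> card S = card T + 2 \<or> card T = card S + 2"
    if "S \<subseteq> {1..n}" "T \<subseteq> {1..n}" "M S T \<noteq> 0" for S T
    using quadratic_moment_sparse[OF f that(1,2)] that(3) by (simp add: M_def)
  have psd: "0 \<le> (\<Sum>S\<in>?P. \<Sum>T\<in>?P. M S T * v S * v T)" for v
  proof -
    have "(\<Sum>S\<in>?P. \<Sum>T\<in>?P. M S T * v S * v T) =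
        (\<Sum>S\<in>?P. \<Sum>T\<in>?P. \<Sum>x\<in>cube n. f x * ((v S * walsh S x) * (v T * walsh T x)))"
      unfolding M_def by (simp add: sum_distrib_left sum_distrib_right mult_ac)
    also have "\<dots> = (\<Sum>S\<in>?P. \<Sum>x\<in>cube n. \<Sum>T\<in>?P. f x * ((v S * walsh S x) * (v T * walsh T x)))"
      by (intro sum.cong refl sum.swap)
    also have "\<dots> = (\<Sum>x\<in>cube n. \<Sum>S\<in>?P. \<Sum>T\<in>?P. f x * ((v S * walsh S x) * (v T * walsh T x)))"
      by (rule sum.swap)
    also have "\<dots> = (\<Sum>x\<in>cube n. f x * (\<Sum>S\<in>?P. v S * walsh S x)\<^sup>2)"
      unfolding power2_eq_square sum_product by (simp add: sum_distrib_left)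
    also have "\<dots> \<ge> 0" using nonneg by (intro sum_nonneg) auto
    finally show ?thesis .
  qed
  have "\<exists>L. (\<forall>S\<in>?P. \<forall>T\<in>?P. M S T = (\<Sum>c\<in>?P. L c S * L c T)) \<and>
      (\<forall>c\<in>?P. \<forall>T\<in>?P. L c T \<noteq> 0 \<longrightarrow> card T \<le> card c \<and> card c \<le> card T + 2)"
  proof (rule banded_cholesky[OF finP(1) _ psd])
    show "M S T = M T S" for S T by (simp add: M_def mult_ac)
    show "card S \<le> card T + 2" if "S \<in> ?P" "T \<in> ?P" "M S T \<noteq> 0" for S T
      using sparse[of S T] that by (auto simp: parity_class_def)
  qed
  then obtain L where L: "\<And>S T. S \<in> ?P \<Longrightarrow> T \<in> ?P \<Longrightarrow> M S T = (\<Sum>c\<in>?P. L c S * L c T)"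
    and band: "\<And>c T. c \<in> ?P \<Longrightarrow> T \<in> ?P \<Longrightarrow> L c T \<noteq> 0 \<Longrightarrow> card T \<le> card c \<and> card c \<le> card T + 2"
    by blast
  have "\<forall>c\<in>?P. \<exists>g. \<forall>x\<in>cube n. (\<Sum>b\<in>?P. L c b * walsh b x)\<^sup>2 = (\<Sum>S\<in>parity_sets n. g S * walsh S x)\<^sup>2"
  proof
    fix c assume "c \<in> ?P"
    then show "\<exists>g. \<forall>x\<in>cube n. (\<Sum>b\<in>?P. L c b * walsh b x)\<^sup>2 =
        (\<Sum>S\<in>parity_sets n. g S * walsh S x)\<^sup>2"
      using band by (intro translate_band[where k = "card c"]) (auto simp: parity_class_def)
  qed
  then obtain g where g: "\<And>c x. c \<in> ?P \<Longrightarrow> x \<in> cube n \<Longrightarrow>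
      (\<Sum>b\<in>?P. L c b * walsh b x)\<^sup>2 = (\<Sum>S\<in>parity_sets n. g c S * walsh S x)\<^sup>2"
    unfolding bchoice_iff by blast
  \<comment> \<open>The factor \<open>2 ^ n\<close> comes from Fourier inversion, and
    \<open>card ?P\<close> from adding up \<open>(walsh S x)\<^sup>2 = 1\<close> over the
    class.\<close>
  define C where "C = 2 ^ n * real (card ?P)"
  have "{1..half_ceil n} \<in> ?P"
    by (auto simp: parity_class_def half_ceil_eq)
  then have "card ?P > 0"
    using finP(1) card_gt_0_iff by blast
  then have C: "C > 0" by (simp add: C_def)
  have total: "C * f x = (\<Sum>c\<in>?P. (\<Sum>S\<in>parity_sets n. g c S * walsh S x)\<^sup>2)" if x: "x \<in> cube n" for x
  proof -
    \<comment> \<open>A nonzero \<open>M S T\<close> forces equal parity, so the sum over the class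
      equals the sum over all subsets, and this is the expansion of
      \<open>f * walsh S\<close>.\<close>
    have row: "(\<Sum>T\<in>?P. M S T * walsh T x) = 2 ^ n * (f x * walsh S x)" if S: "S \<in> ?P" for S
    proof -
      have "(\<Sum>T\<in>?P. M S T * walsh T x) = (\<Sum>T\<in>Pow {1..n}. M S T * walsh T x)"
      proof (intro sum.mono_neutral_left ballI)
        fix T assume T: "T \<in> Pow {1..n} - ?P"
        then have "M S T = 0" using sparse[of S T] S
          by (cases "M S T = 0") (auto simp: parity_class_def)
        then show "M S T * walsh T x = 0" by simp
      qed (auto simp: parity_class_def)
      also have "\<dots> = 2 ^ n * (f x * walsh S x)"
        using walsh_expansion[OF x, of "\<lambda>y. f y * walsh S y"] by (simp add: M_def)
      finally show ?thesis .
    qed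
    have "C * f x = (\<Sum>S\<in>?P. 2 ^ n * (f x * walsh S x) * walsh S x)"
      using walsh_square[OF x] by (simp add: C_def parity_class_def mult.assoc)
    also have "\<dots> = (\<Sum>S\<in>?P. \<Sum>T\<in>?P. M S T * walsh T x * walsh S x)"
      by (intro sum.cong refl) (simp only: row[symmetric] sum_distrib_right)
    also have "\<dots> = (\<Sum>S\<in>?P. \<Sum>T\<in>?P. (\<Sum>c\<in>?P. L c S * L c T) * walsh S x * walsh T x)"
      by (intro sum.cong refl) (simp add: L mult.commute mult.left_commute)
    also have "\<dots> = (\<Sum>c\<in>?P. (\<Sum>S\<in>?P. L c S * walsh S x)\<^sup>2)"
      by (rule gram_quadratic_form)
    also have "\<dots> = (\<Sum>c\<in>?P. (\<Sum>S\<in>parity_sets n. g c S * walsh S x)\<^sup>2)"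
      using g x by simp
    finally show ?thesis .
  qed
  have "f x = (\<Sum>c\<in>?P. (\<Sum>S\<in>parity_sets n. (g c S / sqrt C) * walsh S x)\<^sup>2)" if "x \<in> cube n" for x
  proof -
    have "(\<Sum>S\<in>parity_sets n. (g c S / sqrt C) * walsh S x)\<^sup>2 =
        (\<Sum>S\<in>parity_sets n. g c S * walsh S x)\<^sup>2 / C" for c
      using C by (simp add: sum_divide_distrib[symmetric] power_divide)
    then show ?thesis
      using total[OF that] C by (simp add: sum_divide_distrib[symmetric] field_simps)
  qed
  \<comment> \<open>The number of squares drops from \<open>card ?P\<close> to the cardinality of
    \<open>parity_sets n\<close>.\<close>
  moreover obtain L' where "\<forall>\<chi>. (\<Sum>c\<in>?P. (\<Sum>S\<in>parity_sets n. (g c S / sqrt C) * \<chi> S)\<^sup>2) =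
      (\<Sum>c\<in>parity_sets n. (\<Sum>S\<in>parity_sets n. L' c S * \<chi> S)\<^sup>2)"
    using sum_squares_card[OF finP(2), where K = ?P and g = "\<lambda>c S. g c S / sqrt C"] by blast
  ultimately show ?thesis by (intro exI[of _ L']) simp
qed

theorem theorem2:
  fixes n :: nat
    and A0 :: real
    and A :: "nat \<Rightarrow> nat \<Rightarrow> real"
    and f :: "(nat \<Rightarrow> real) \<Rightarrow> real"
  assumes "n \<ge> 1"
    and "\<forall>x\<in>cube n. f x =
           A0 + (\<Sum>(i, j) \<in> {(i, j). 1 \<le> i \<and> i < j \<and> j \<le> n}. A i j * x i * x j)"
    and "\<forall>x\<in>cube n. f x \<ge> 0"
  shows "(\<exists>h :: nat \<Rightarrow> (nat \<Rightarrow> real) \<Rightarrow> real.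
            (\<forall>k\<in>{1..card (parity_sets n)}. supported_on n (h k) (parity_sets n)) \<and>
            (\<forall>x\<in>cube n. f x = (\<Sum>k = 1..card (parity_sets n). (h k x)\<^sup>2))) \<and>
         (\<exists>(m :: nat) (h :: nat \<Rightarrow> (nat \<Rightarrow> real) \<Rightarrow> real).
            (\<forall>k\<in>{1..m}. degree_at_most n (h k) (half_ceil n)) \<and>
            (\<forall>x\<in>cube n. f x = (\<Sum>k = 1..m. (h k x)\<^sup>2)))"
proof -
  let ?T = "parity_sets n" and ?m = "card (parity_sets n)"
  have T: "finite ?T" "?T \<subseteq> Pow {1..n}"
    by (auto simp: parity_sets_def)
  obtain L where L: "\<forall>x\<in>cube n. f x = (\<Sum>c\<in>?T. (\<Sum>S\<in>?T. L c S * walsh S x)\<^sup>2)"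
    using quadratic_sum_of_squares[OF assms(2,3)] by blast
  obtain e where e: "bij_betw e {1..?m} ?T"
    using ex_bij_betw_nat_finite_1[OF T(1)] by blast
  define h where "h k x = (\<Sum>S\<in>?T. L (e k) S * walsh S x)" for k x
  have supp: "supported_on n (h k) ?T" for k
    using T(2) by (rule supported_on_walsh_sum[where g = "L (e k)"]) (simp add: h_def)
  \<comment> \<open>Sets with more than \<open>half_ceil n\<close> elements are outside
    \<open>parity_sets n\<close>, so the same functions serve the second claim.\<close>
  then have deg: "degree_at_most n (h k) (half_ceil n)" for k
    unfolding supported_on_def degree_at_most_def parity_sets_def by fastforce
  have "\<forall>x\<in>cube n. f x = (\<Sum>k = 1..?m. (h k x)\<^sup>2)"
    using L by (simp add: h_def sum.reindex_bij_betw[OF e, symmetric])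
  then show ?thesis using supp deg by blast
qed

end
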